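(* Let $\mathcal X=(\Omega,S)$ be a coherent configuration and $\mu\in\Omega$. Assume that: (i) for every $\Delta\subseteq\Omega$ with $|\Delta|\le4$ there is $\lambda\in\Omega$ such that $\delta\leftarrow\lambda$ for all $\delta\in\Delta$ (with respect to $\mu$); (ii) for all $\alpha,\beta,\gamma\in\Omega$ there is $m\in S$ with $\mu m\ne\varnothing$ such that the couple $Q_\mu(\alpha,\beta,\gamma)$ has an $m$-extension. Then for every coherent configuration $\mathcal X'=(\Omega',S')$, every algebraic isomorphism $\varphi:\mathcal X\to\mathcal X'$, and every $\mu'\in\Omega'$ with $\varphi(r_{\mathcal X}(\mu,\mu))=r_{\mathcal X'}(\mu',\mu')$, the algebraic isomorphism $\varphi$ is induced by an isomorphism $f:\Omega\to\Omega'$ with $\mu^f=\mu'$. In particular, $\mathcal X$ is separable.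
   Context: A coherent configuration is a pair $\mathcal X=(\Omega,S)$, where $\Omega$ is a finite set and $S$ is a partition of $\Omega\times\Omega$ such that the diagonal $1_\Omega$ is a union of elements of $S$, $S$ is closed under $r\mapsto r^*=\{(\beta,\alpha):(\alpha,\beta)\in r\}$, and for all $r,s,t\in S$ the number $c_{rs}^t=|\alpha r\cap\beta s^*|$ does not depend on $(\alpha,\beta)\in t$, where $\alpha r=\{\beta:(\alpha,\beta)\in r\}$. $r(\alpha,\beta)=r_{\mathcal X}(\alpha,\beta)$ denotes the unique element of $S$ containing $(\alpha,\beta)$. For $r,s\in S$ the complex product $rs$ is the set of $t\in S$ with $c_{rs}^t\ne0$ (equivalently, $t\subseteq\{(\alpha,\beta):\exists\gamma,(\alpha,\gamma)\in r,(\gamma,\beta)\in s\}$). An isomorphism from $\mathcal X$ to $\mathcal X'=(\Omega',S')$ is a bijection $f:\Omega\to\Omega'$ with $\{s^f:s\in S\}=S'$; an algebraic isomorphism is a bijection $\varphi:S\to S'$ with $c_{rs}^t=c_{\varphi(r)\varphi(s)}^{\varphi(t)}$ for all $r,s,t$; it is induced by $f$ if $\varphi(s)=s^f$ for all $s$. $\mathcal X$ is separable if every algebraic isomorphism from $\mathcal X$ to any coherent configuration is induced by an isomorphism. For the fixed point $\mu$ and $\alpha,\beta\in\Omega$, write $\alpha\leftarrow\beta$ if $c_{xr}^y=1$, where $x=r(\mu,\alpha)$, $r=r(\alpha,\beta)$, $y=r(\mu,\beta)$. For $\alpha,\beta,\gamma\in\Omega$, the couple $Q_\mu(\alpha,\beta,\gamma)$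 is the $6$-tuple $(x,y,z;r,s,t)$ with $x=r(\mu,\alpha)$, $y=r(\mu,\beta)$, $z=r(\mu,\gamma)$, $r=r(\alpha,\beta)$, $s=r(\beta,\gamma)$, $t=r(\gamma,\alpha)$. For $m\in S$, an $m$-extension of such a couple is a triple $(\bar x,\bar y,\bar z)\in S^3$ with $\bar x\in m^*x$, $\bar y\in m^*y$, $\bar z\in m^*z$ and $x^*y\cap\bar x^*\bar y=\{r\}$, $y^*z\cap\bar y^*\bar z=\{s\}$, $z^*x\cap\bar z^*\bar x=\{t\}$ (complex products). *)

theory Defs
  imports Main "HOL-Library.Disjoint_Sets"
begin

text \<open>A configuration on the finite set \<open>\<Omega>\<close> is given by \<open>\<Omega>\<close> and the set \<open>S\<close> of its basis
  relations. The out-neighbourhood \<open>\<alpha>r\<close> is \<open>r `` {\<alpha>}\<close> and \<open>r\<^sup>*\<close> is the converse of \<open>r\<close>.\<close>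

definition path_count :: "'a rel \<Rightarrow> 'a rel \<Rightarrow> 'a \<Rightarrow> 'a \<Rightarrow> nat" where
  "path_count r s \<alpha> \<beta> = card (r `` {\<alpha>} \<inter> (converse s) `` {\<beta>})"

locale coherent_configuration =
  fixes \<Omega> :: "'a set" and S :: "'a rel set"
  assumes finite_points: "finite \<Omega>"
    and partition: "partition_on (\<Omega> \<times> \<Omega>) S"
    and diagonal: "\<exists>T \<subseteq> S. Id_on \<Omega> = \<Union> T"
    and converse_closed: "\<And>r. r \<in> S \<Longrightarrow> converse r \<in> S"
    and coherent: "\<And>r s t \<alpha> \<beta> \<alpha>' \<beta>'. \<lbrakk>r \<in> S; s \<in> S; t \<in> S; (\<alpha>, \<beta>) \<in> t; (\<alpha>', \<beta>') \<in> t\<rbrakk>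
      \<Longrightarrow> path_count r s \<alpha> \<beta> = path_count r s \<alpha>' \<beta>'"

text \<open>The intersection number \<open>c\<^sub>r\<^sub>s\<^sup>t\<close>. It is well defined when \<open>r, s, t\<close> are basis relations of a
  coherent configuration, since these are nonempty; it is arbitrary otherwise.\<close>

definition intersection_number :: "'a rel \<Rightarrow> 'a rel \<Rightarrow> 'a rel \<Rightarrow> nat" where
  "intersection_number r s t = (THE k. \<forall>(\<alpha>, \<beta>) \<in> t. path_count r s \<alpha> \<beta> = k)"

definition basis_rel :: "'a rel set \<Rightarrow> 'a \<Rightarrow> 'a \<Rightarrow> 'a rel" where
  "basis_rel S \<alpha> \<beta> = (THE s. s \<in> S \<and> (\<alpha>, \<beta>) \<in> s)"

definition complex_product :: "'a rel set \<Rightarrow> 'a rel \<Rightarrow> 'a rel \<Rightarrow> 'a rel set" where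
  "complex_product S r s = {t \<in> S. intersection_number r s t \<noteq> 0}"

definition rel_image :: "('a \<Rightarrow> 'b) \<Rightarrow> 'a rel \<Rightarrow> 'b rel" where
  "rel_image f s = map_prod f f ` s"

definition cc_isomorphism ::
  "'a set \<Rightarrow> 'a rel set \<Rightarrow> 'b set \<Rightarrow> 'b rel set \<Rightarrow> ('a \<Rightarrow> 'b) \<Rightarrow> bool" where
  "cc_isomorphism \<Omega> S \<Omega>' S' f \<longleftrightarrow> bij_betw f \<Omega> \<Omega>' \<and> rel_image f ` S = S'"

definition algebraic_isomorphism ::
  "'a rel set \<Rightarrow> 'b rel set \<Rightarrow> ('a rel \<Rightarrow> 'b rel) \<Rightarrow> bool" where
  "algebraic_isomorphism S S' \<phi> \<longleftrightarrow> bij_betw \<phi> S S' \<and>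
     (\<forall>r\<in>S. \<forall>s\<in>S. \<forall>t\<in>S.
        intersection_number r s t = intersection_number (\<phi> r) (\<phi> s) (\<phi> t))"

definition induces :: "'a rel set \<Rightarrow> ('a \<Rightarrow> 'b) \<Rightarrow> ('a rel \<Rightarrow> 'b rel) \<Rightarrow> bool" where
  "induces S f \<phi> \<longleftrightarrow> (\<forall>s\<in>S. \<phi> s = rel_image f s)"

text \<open>HOL cannot quantify over types inside a formula, so the type carrying the points of the
  target configurations is a parameter. Separability is \<open>separable TYPE('b) \<Omega> S\<close> for every
  type \<open>'b\<close>, which is what a theorem with \<open>'b\<close> as a free type variable asserts.\<close>

definition separable :: "'b itself \<Rightarrow> 'a set \<Rightarrow> 'a rel set \<Rightarrow> bool" where
  "separable (_ :: 'b itself) \<Omega> S \<longleftrightarrow>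
     (\<forall>(\<Omega>' :: 'b set) S' \<phi>.
        coherent_configuration \<Omega>' S' \<and> algebraic_isomorphism S S' \<phi> \<longrightarrow>
        (\<exists>f. cc_isomorphism \<Omega> S \<Omega>' S' f \<and> induces S f \<phi>))"

text \<open>\<open>base_arrow S \<mu> \<alpha> \<beta>\<close> is \<open>\<alpha> \<leftarrow> \<beta>\<close> with respect to the point \<open>\<mu>\<close>.\<close>

definition base_arrow :: "'a rel set \<Rightarrow> 'a \<Rightarrow> 'a \<Rightarrow> 'a \<Rightarrow> bool" where
  "base_arrow S \<mu> \<alpha> \<beta> \<longleftrightarrow>
     intersection_number (basis_rel S \<mu> \<alpha>) (basis_rel S \<alpha> \<beta>) (basis_rel S \<mu> \<beta>) = 1"

type_synonym 'a couple = "'a rel \<times> 'a rel \<times> 'a rel \<times> 'a rel \<times> 'a rel \<times> 'a rel"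

definition couple :: "'a rel set \<Rightarrow> 'a \<Rightarrow> 'a \<Rightarrow> 'a \<Rightarrow> 'a \<Rightarrow> 'a couple" where
  "couple S \<mu> \<alpha> \<beta> \<gamma> =
     (basis_rel S \<mu> \<alpha>, basis_rel S \<mu> \<beta>, basis_rel S \<mu> \<gamma>,
      basis_rel S \<alpha> \<beta>, basis_rel S \<beta> \<gamma>, basis_rel S \<gamma> \<alpha>)"

definition is_extension ::
  "'a rel set \<Rightarrow> 'a rel \<Rightarrow> 'a couple \<Rightarrow> 'a rel \<times> 'a rel \<times> 'a rel \<Rightarrow> bool" where
  "is_extension S m = (\<lambda>(x, y, z, r, s, t) (x', y', z').
     x' \<in> S \<and> y' \<in> S \<and> z' \<in> S \<and>
     x' \<in> complex_product S (converse m) x \<and>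
     y' \<in> complex_product S (converse m) y \<and>
     z' \<in> complex_product S (converse m) z \<and>
     complex_product S (converse x) y \<inter> complex_product S (converse x') y' = {r} \<and>
     complex_product S (converse y) z \<inter> complex_product S (converse y') z' = {s} \<and>
     complex_product S (converse z) x \<inter> complex_product S (converse z') x' = {t})"

end

theory Submission
  imports Defs
begin

text \<open>Fix an algebraic isomorphism \<open>\<phi>\<close> and \<open>\<mu>'\<close>. If \<open>\<alpha> \<leftarrow> \<kappa>\<close>, then a point \<open>\<kappa>'\<close> that sits over
  \<open>\<mu>'\<close> as \<open>\<kappa>\<close> sits over \<open>\<mu>\<close> determines a unique image \<open>\<alpha>'\<close> of \<open>\<alpha>\<close>. Hypothesis (ii) shows that the
  partial maps \<open>\<alpha> \<mapsto> \<alpha>'\<close> so obtained respect \<open>\<phi>\<close>, and hypothesis (i), applied to two points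
  together with two choices of \<open>\<kappa>\<close>, shows that the set of image pairs of a pair of points does not
  depend on \<open>\<kappa>\<close>. These image pairs extend to third points, so the relation ``the image of \<open>\<omega>\<close>
  determines the image of \<open>\<delta>\<close>'' is transitive. It is also directed, and therefore some \<open>\<omega>\<close> determines
  all points; any choice of the image of this \<open>\<omega>\<close> yields the isomorphism.\<close>

section \<open>Basis relations and intersection numbers of a single configuration\<close>

context coherent_configuration
begin

lemma basis_rel_unique:
  assumes "s \<in> S" "t \<in> S" "p \<in> s" "p \<in> t"
  shows "s = t"
  using partition_onD2[OF partition] assms unfolding disjoint_def by blast

lemma basis_rel_eqI: "s \<in> S \<Longrightarrow> (\<alpha>, \<beta>) \<in> s \<Longrightarrow> basis_rel S \<alpha> \<beta> = s"
  unfolding basis_rel_def by (rule the_equality) (use basis_rel_unique in metis)+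

lemma basis_rel_points:
  assumes "s \<in> S" "(\<alpha>, \<beta>) \<in> s"
  shows "\<alpha> \<in> \<Omega>" "\<beta> \<in> \<Omega>"
  using partition_onD1[OF partition] assms by auto

lemma basis_rel_mem:
  assumes "\<alpha> \<in> \<Omega>" "\<beta> \<in> \<Omega>"
  shows "basis_rel S \<alpha> \<beta> \<in> S" "(\<alpha>, \<beta>) \<in> basis_rel S \<alpha> \<beta>"
proof -
  have "(\<alpha>, \<beta>) \<in> \<Union>S"
    using partition_onD1[OF partition] assms by auto
  then obtain s where "s \<in> S" "(\<alpha>, \<beta>) \<in> s" by blast
  then show "basis_rel S \<alpha> \<beta> \<in> S" "(\<alpha>, \<beta>) \<in> basis_rel S \<alpha> \<beta>"
    by (simp_all add: basis_rel_eqI)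
qed

lemma basis_rel_nonempty: "s \<in> S \<Longrightarrow> \<exists>\<alpha> \<beta>. (\<alpha>, \<beta>) \<in> s"
  using partition_onD3[OF partition] by (metis ex_in_conv surj_pair)

lemma basis_rel_converse:
  "\<alpha> \<in> \<Omega> \<Longrightarrow> \<beta> \<in> \<Omega> \<Longrightarrow> basis_rel S \<beta> \<alpha> = converse (basis_rel S \<alpha> \<beta>)"
  by (simp add: basis_rel_eqI basis_rel_mem converse_closed)

text \<open>The diagonal is a union of basis relations and these are disjoint, so meeting it in one
  pair puts all of \<open>d\<close> inside it.\<close>

lemma diagonal_basis_rel:
  assumes "d \<in> S" "(\<alpha>, \<alpha>) \<in> d"
  shows "d \<subseteq> Id"
proof -
  obtain T where T: "T \<subseteq> S" "Id_on \<Omega> = \<Union>T" using diagonal by blast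
  moreover have "(\<alpha>, \<alpha>) \<in> Id_on \<Omega>"
    using basis_rel_points(1)[OF assms] by (rule Id_onI)
  ultimately obtain t where "t \<in> T" "(\<alpha>, \<alpha>) \<in> t" by auto
  then have "d \<in> T" using basis_rel_unique assms T(1) by blast
  then have "d \<subseteq> Id_on \<Omega>" using T(2) by blast
  then show ?thesis by auto
qed

text \<open>A pair in \<open>t\<close> pins down the definite description, which coherence makes
  single-valued.\<close>

lemma intersection_number_eq:
  assumes "r \<in> S" "s \<in> S" "t \<in> S" "(\<alpha>, \<beta>) \<in> t"
  shows "intersection_number r s t = card {\<gamma>. (\<alpha>, \<gamma>) \<in> r \<and> (\<gamma>, \<beta>) \<in> s}"
proof -
  have "intersection_number r s t = path_count r s \<alpha> \<beta>"
    unfolding intersection_number_def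
    using assms(4) by (intro the_equality) (auto intro: coherent[OF assms(1-3)])
  moreover have "r `` {\<alpha>} \<inter> converse s `` {\<beta>} = {\<gamma>. (\<alpha>, \<gamma>) \<in> r \<and> (\<gamma>, \<beta>) \<in> s}"
    by auto
  ultimately show ?thesis by (simp add: path_count_def)
qed

lemma intersection_number_nonzero:
  assumes "r \<in> S" "s \<in> S" "t \<in> S" "(\<alpha>, \<beta>) \<in> t"
  shows "intersection_number r s t \<noteq> 0 \<longleftrightarrow> (\<exists>\<gamma>. (\<alpha>, \<gamma>) \<in> r \<and> (\<gamma>, \<beta>) \<in> s)"
proof -
  have "finite {\<gamma>. (\<alpha>, \<gamma>) \<in> r \<and> (\<gamma>, \<beta>) \<in> s}"
    using basis_rel_points(2)[OF assms(1)] by (auto intro: finite_subset[OF _ finite_points])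
  then show ?thesis by (auto simp: intersection_number_eq[OF assms])
qed

text \<open>The out-neighbourhoods of a point partition the point set, and each is counted by walks
  along \<open>s\<close> and back. So the number of points is expressed by data that an algebraic
  isomorphism can carry over.\<close>

lemma card_points_eq_sum_valencies:
  assumes "\<alpha> \<in> \<Omega>"
  shows "card \<Omega> = (\<Sum>s\<in>S. intersection_number s (converse s) (basis_rel S \<alpha> \<alpha>))"
proof -
  have fin: "finite S"
    by (rule finite_elements[OF _ partition]) (simp add: finite_points)
  have sub: "s `` {\<alpha>} \<subseteq> \<Omega>" if "s \<in> S" for s
    using basis_rel_points(2)[OF that] by auto
  have "\<Omega> = (\<Union>s\<in>S. s `` {\<alpha>})"
    using sub basis_rel_mem[OF assms] by blast
  then have "card \<Omega> = card (\<Union>s\<in>S. s `` {\<alpha>})" by simp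
  also have "\<dots> = (\<Sum>s\<in>S. card (s `` {\<alpha>}))"
    using fin sub finite_points
    by (intro card_UN_disjoint) (auto intro: finite_subset dest: basis_rel_unique)
  also have "\<dots> = (\<Sum>s\<in>S. intersection_number s (converse s) (basis_rel S \<alpha> \<alpha>))"
  proof (rule sum.cong[OF refl])
    fix s assume "s \<in> S"
    then show "card (s `` {\<alpha>}) = intersection_number s (converse s) (basis_rel S \<alpha> \<alpha>)"
      using intersection_number_eq[of s "converse s" _ \<alpha> \<alpha>] basis_rel_mem[OF assms assms]
      by (simp add: converse_closed Image_def)
  qed
  finally show ?thesis .
qed

end

section \<open>Algebraic isomorphisms and pairs of points matched by them\<close>

locale algebraic_iso = X: coherent_configuration \<Omega> S + Y: coherent_configuration \<Omega>' S'
  for \<Omega> :: "'a set" and S and \<Omega>' :: "'b set" and S' +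
  fixes \<phi> :: "'a rel \<Rightarrow> 'b rel"
  assumes alg_iso: "algebraic_isomorphism S S' \<phi>"
begin

abbreviation R :: "'a \<Rightarrow> 'a \<Rightarrow> 'a rel" where "R \<equiv> basis_rel S"
abbreviation R' :: "'b \<Rightarrow> 'b \<Rightarrow> 'b rel" where "R' \<equiv> basis_rel S'"

lemma phi_mem: "s \<in> S \<Longrightarrow> \<phi> s \<in> S'"
  using alg_iso by (auto simp: algebraic_isomorphism_def dest: bij_betwE)

lemma phi_inj: "s \<in> S \<Longrightarrow> t \<in> S \<Longrightarrow> \<phi> s = \<phi> t \<longleftrightarrow> s = t"
  using alg_iso by (auto simp: algebraic_isomorphism_def bij_betw_def dest: inj_onD)

lemma phi_surj: "s' \<in> S' \<Longrightarrow> \<exists>s\<in>S. s' = \<phi> s"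
  using alg_iso by (auto simp: algebraic_isomorphism_def bij_betw_def)

lemma phi_intersection_number:
  "r \<in> S \<Longrightarrow> s \<in> S \<Longrightarrow> t \<in> S \<Longrightarrow>
    intersection_number (\<phi> r) (\<phi> s) (\<phi> t) = intersection_number r s t"
  using alg_iso by (simp add: algebraic_isomorphism_def)

text \<open>Preserved intersection numbers are nonzero together. This moves triangles between the
  two configurations, in both directions.\<close>

lemma phi_path:
  assumes "r \<in> S" "s \<in> S" "t \<in> S" "(\<alpha>, \<beta>) \<in> t" "(\<alpha>', \<beta>') \<in> \<phi> t"
  shows "(\<exists>\<gamma>'. (\<alpha>', \<gamma>') \<in> \<phi> r \<and> (\<gamma>', \<beta>') \<in> \<phi> s) \<longleftrightarrow> (\<exists>\<gamma>. (\<alpha>, \<gamma>) \<in> r \<and> (\<gamma>, \<beta>) \<in> s)"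
  using X.intersection_number_nonzero[OF assms(1-4)] phi_intersection_number[OF assms(1-3)]
    Y.intersection_number_nonzero[OF phi_mem phi_mem phi_mem assms(5), OF assms(1-3)]
  by simp

lemma phi_diagonal:
  assumes "d \<in> S" "(\<alpha>, \<alpha>) \<in> d" "(\<alpha>', \<beta>') \<in> \<phi> d"
  shows "\<alpha>' = \<beta>'"
proof -
  have a': "\<alpha>' \<in> \<Omega>'" using Y.basis_rel_points(1)[OF phi_mem] assms by blast
  obtain e where e: "e \<in> S" "R' \<alpha>' \<alpha>' = \<phi> e"
    using phi_surj Y.basis_rel_mem(1)[OF a' a'] by blast
  have "(\<alpha>', \<alpha>') \<in> \<phi> e" using e(2) Y.basis_rel_mem(2)[OF a' a'] by simp
  \<comment> \<open>The path that first stays at \<open>\<alpha>'\<close> and then goes to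
    \<open>\<beta>'\<close> is pulled back; as \<open>d\<close> is diagonal, its middle point must
    be \<open>\<alpha>\<close>, which forces \<open>e = d\<close>.\<close>
  then obtain \<gamma> where "(\<alpha>, \<gamma>) \<in> e" "(\<gamma>, \<alpha>) \<in> d"
    using phi_path[OF e(1) assms(1,1,2,3)] assms(3) by blast
  moreover from this have "\<gamma> = \<alpha>" using X.diagonal_basis_rel[OF assms(1,2)] by blast
  ultimately have "e = d" using X.basis_rel_unique e(1) assms(1) by blast
  then have "\<phi> d \<subseteq> Id"
    using Y.diagonal_basis_rel[OF phi_mem] e(1) \<open>(\<alpha>', \<alpha>') \<in> \<phi> e\<close> by blast
  then show ?thesis using assms(3) by blast
qed

text \<open>A walk along \<open>s\<close> and back lies over a diagonal relation. By
  \<open>phi_diagonal\<close> its image is again a closed walk, so the two basis relations share a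
  pair and coincide.\<close>

lemma phi_converse:
  assumes "s \<in> S"
  shows "\<phi> (converse s) = converse (\<phi> s)"
proof -
  obtain \<alpha> \<beta> where ab: "(\<alpha>, \<beta>) \<in> s" using X.basis_rel_nonempty[OF assms] by blast
  have a: "\<alpha> \<in> \<Omega>" using X.basis_rel_points(1)[OF assms ab] .
  note d = X.basis_rel_mem[OF a a]
  obtain \<alpha>' \<beta>' where ab': "(\<alpha>', \<beta>') \<in> \<phi> (R \<alpha> \<alpha>)"
    using Y.basis_rel_nonempty[OF phi_mem[OF d(1)]] by blast
  have "\<alpha>' = \<beta>'" using phi_diagonal[OF d ab'] .
  moreover obtain \<gamma>' where "(\<alpha>', \<gamma>') \<in> \<phi> s" "(\<gamma>', \<beta>') \<in> \<phi> (converse s)"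
    using phi_path[OF assms X.converse_closed[OF assms] d ab'] ab by blast
  ultimately have "(\<gamma>', \<alpha>') \<in> \<phi> (converse s)" "(\<gamma>', \<alpha>') \<in> converse (\<phi> s)" by auto
  then show ?thesis
    using Y.basis_rel_unique phi_mem X.converse_closed Y.converse_closed assms by meson
qed

text \<open>Compatibility of a two-point partial map with \<open>\<phi>\<close>. Membership in the
  point sets is included because \<open>basis_rel\<close> is unspecified outside them.\<close>

definition corr :: "'a \<Rightarrow> 'b \<Rightarrow> 'a \<Rightarrow> 'b \<Rightarrow> bool" where
  "corr \<alpha> \<alpha>' \<beta> \<beta>' \<longleftrightarrow>
     \<alpha> \<in> \<Omega> \<and> \<beta> \<in> \<Omega> \<and> \<alpha>' \<in> \<Omega>' \<and> \<beta>' \<in> \<Omega>' \<and> R' \<alpha>' \<beta>' = \<phi> (R \<alpha> \<beta>)"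

lemma corrI: "s \<in> S \<Longrightarrow> (\<alpha>, \<beta>) \<in> s \<Longrightarrow> (\<alpha>', \<beta>') \<in> \<phi> s \<Longrightarrow> corr \<alpha> \<alpha>' \<beta> \<beta>'"
  unfolding corr_def
  using X.basis_rel_points Y.basis_rel_points phi_mem X.basis_rel_eqI Y.basis_rel_eqI by metis

lemma corr_mem_iff: "s \<in> S \<Longrightarrow> corr \<alpha> \<alpha>' \<beta> \<beta>' \<Longrightarrow> (\<alpha>', \<beta>') \<in> \<phi> s \<longleftrightarrow> (\<alpha>, \<beta>) \<in> s"
  unfolding corr_def
  by (metis X.basis_rel_eqI X.basis_rel_mem Y.basis_rel_eqI Y.basis_rel_mem(2) phi_inj phi_mem)

lemma corr_sym: "corr \<alpha> \<alpha>' \<beta> \<beta>' \<Longrightarrow> corr \<beta> \<beta>' \<alpha> \<alpha>'"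
  unfolding corr_def
  by (metis X.basis_rel_converse X.basis_rel_mem(1) Y.basis_rel_converse phi_converse)

text \<open>The degenerate path \<open>\<alpha>, \<alpha>, \<beta>\<close> transfers to one over
  \<open>(\<alpha>', \<alpha>')\<close>, whose first step is diagonal. Pulling this step back puts
  \<open>(\<alpha>, \<beta>)\<close> into a diagonal relation.\<close>

lemma corr_injective: "corr \<alpha> \<alpha>' \<beta> \<alpha>' \<Longrightarrow> \<alpha> = \<beta>"
proof -
  assume c: "corr \<alpha> \<alpha>' \<beta> \<alpha>'"
  then have a: "\<alpha>' \<in> \<Omega>'" "\<alpha> \<in> \<Omega>" "\<beta> \<in> \<Omega>" by (auto simp: corr_def)
  note e = X.basis_rel_mem[OF a(2,2)]
  have "(\<alpha>', \<alpha>') \<in> \<phi> (R \<alpha> \<beta>)"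
    using c Y.basis_rel_mem(2)[OF a(1,1)] by (simp add: corr_def)
  then have "\<exists>\<gamma>'. (\<alpha>', \<gamma>') \<in> \<phi> (R \<alpha> \<alpha>) \<and> (\<gamma>', \<alpha>') \<in> \<phi> (R \<alpha> \<beta>)"
    using phi_path[OF e(1) X.basis_rel_mem(1,1,2)[OF a(2,3)]] e X.basis_rel_mem(2)[OF a(2,3)]
    by blast
  then have "(\<alpha>', \<alpha>') \<in> \<phi> (R \<alpha> \<alpha>)" using phi_diagonal[OF e] by blast
  then have "(\<alpha>, \<beta>) \<in> R \<alpha> \<alpha>" using corr_mem_iff[OF e(1) c] by blast
  then show "\<alpha> = \<beta>" using X.diagonal_basis_rel[OF e] by blast
qed

lemma corr_extend:
  assumes "corr \<alpha> \<alpha>' \<beta> \<beta>'" "\<gamma> \<in> \<Omega>"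
  obtains \<gamma>' where "corr \<alpha> \<alpha>' \<gamma> \<gamma>'" "corr \<gamma> \<gamma>' \<beta> \<beta>'"
proof -
  have ab: "\<alpha> \<in> \<Omega>" "\<beta> \<in> \<Omega>" using assms(1) by (auto simp: corr_def)
  note ag = X.basis_rel_mem[OF ab(1) assms(2)] and gb = X.basis_rel_mem[OF assms(2) ab(2)]
  note m = X.basis_rel_mem[OF ab]
  have "(\<alpha>', \<beta>') \<in> \<phi> (R \<alpha> \<beta>)" using corr_mem_iff[OF m(1) assms(1)] m(2) by blast
  then obtain \<gamma>' where "(\<alpha>', \<gamma>') \<in> \<phi> (R \<alpha> \<gamma>)" "(\<gamma>', \<beta>') \<in> \<phi> (R \<gamma> \<beta>)"
    using phi_path[OF ag(1) gb(1) m] ag(2) gb(2) by blast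
  then show thesis using that corrI ag gb by meson
qed

lemma card_points_eq:
  assumes "\<mu> \<in> \<Omega>" "\<mu>' \<in> \<Omega>'" "\<phi> (R \<mu> \<mu>) = R' \<mu>' \<mu>'"
  shows "card \<Omega> = card \<Omega>'"
proof -
  have bij: "bij_betw \<phi> S S'" using alg_iso by (simp add: algebraic_isomorphism_def)
  have "card \<Omega>' = (\<Sum>s\<in>S. intersection_number (\<phi> s) (converse (\<phi> s)) (R' \<mu>' \<mu>'))"
    unfolding Y.card_points_eq_sum_valencies[OF assms(2)]
    by (rule sum.reindex_bij_betw[OF bij, symmetric])
  also have "\<dots> = (\<Sum>s\<in>S. intersection_number s (converse s) (R \<mu> \<mu>))"
    by (intro sum.cong refl)
       (simp flip: assms(3) phi_converse
         add: phi_intersection_number X.converse_closed X.basis_rel_mem assms(1))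
  finally show ?thesis using X.card_points_eq_sum_valencies[OF assms(1)] by simp
qed

lemma induced_by_corr_map:
  assumes "card \<Omega> = card \<Omega>'" and corr: "\<And>\<alpha> \<beta>. \<alpha> \<in> \<Omega> \<Longrightarrow> \<beta> \<in> \<Omega> \<Longrightarrow> corr \<alpha> (f \<alpha>) \<beta> (f \<beta>)"
  shows "cc_isomorphism \<Omega> S \<Omega>' S' f \<and> induces S f \<phi>"
proof -
  have inj: "inj_on f \<Omega>"
    by (rule inj_onI) (metis corr corr_injective)
  have "f ` \<Omega> \<subseteq> \<Omega>'" using corr by (auto simp: corr_def)
  \<comment> \<open>Surjectivity comes from counting: an injection between finite sets of equal
    size.\<close>
  then have im: "f ` \<Omega> = \<Omega>'"
    using card_subset_eq[OF Y.finite_points] assms(1) card_image[OF inj] by metis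
  have img: "rel_image f s = \<phi> s" if s: "s \<in> S" for s
  proof (rule set_eqI, clarify)
    fix \<alpha>' \<beta>'
    show "(\<alpha>', \<beta>') \<in> rel_image f s \<longleftrightarrow> (\<alpha>', \<beta>') \<in> \<phi> s"
    proof
      assume "(\<alpha>', \<beta>') \<in> rel_image f s"
      then obtain \<alpha> \<beta> where "(\<alpha>, \<beta>) \<in> s" "\<alpha>' = f \<alpha>" "\<beta>' = f \<beta>"
        by (auto simp: rel_image_def)
      then show "(\<alpha>', \<beta>') \<in> \<phi> s"
        using corr_mem_iff[OF s corr] X.basis_rel_points[OF s] by blast
    next
      assume s': "(\<alpha>', \<beta>') \<in> \<phi> s"
      then have "\<alpha>' \<in> f ` \<Omega>" "\<beta>' \<in> f ` \<Omega>"
        using Y.basis_rel_points[OF phi_mem[OF s] s'] im by simp_all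
      then obtain \<alpha> \<beta> where ab: "\<alpha> \<in> \<Omega>" "\<beta> \<in> \<Omega>" "\<alpha>' = f \<alpha>" "\<beta>' = f \<beta>" by blast
      then have "(\<alpha>, \<beta>) \<in> s" using corr_mem_iff[OF s corr] s' by blast
      then show "(\<alpha>', \<beta>') \<in> rel_image f s"
        using ab(3,4) by (force simp: rel_image_def)
    qed
  qed
  then have "rel_image f ` S = \<phi> ` S" by (rule image_cong[OF refl])
  then show ?thesis
    using img inj im alg_iso
    by (simp add: cc_isomorphism_def induces_def bij_betw_def algebraic_isomorphism_def)
qed

end

section \<open>Base points, and the transfer of triangles by means of extensions\<close>

locale pointed_algebraic_iso = algebraic_iso \<Omega> S \<Omega>' S' \<phi>
  for \<Omega> :: "'a set" and S and \<Omega>' :: "'b set" and S' and \<phi> +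
  fixes \<mu> :: 'a and \<mu>' :: 'b
  assumes base_point: "\<mu> \<in> \<Omega>" and base_point': "\<mu>' \<in> \<Omega>'"
    and phi_base_point: "\<phi> (basis_rel S \<mu> \<mu>) = basis_rel S' \<mu>' \<mu>'"
    and dominated: "\<And>\<Delta>. \<Delta> \<subseteq> \<Omega> \<Longrightarrow> card \<Delta> \<le> 4 \<Longrightarrow> \<exists>l\<in>\<Omega>. \<forall>\<delta>\<in>\<Delta>. base_arrow S \<mu> \<delta> l"
    and extendable: "\<And>\<alpha> \<beta> \<gamma>. \<alpha> \<in> \<Omega> \<Longrightarrow> \<beta> \<in> \<Omega> \<Longrightarrow> \<gamma> \<in> \<Omega> \<Longrightarrow>
      \<exists>m\<in>S. \<exists>E. is_extension S m (couple S \<mu> \<alpha> \<beta> \<gamma>) E"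
begin

abbreviation arrow :: "'a \<Rightarrow> 'a \<Rightarrow> bool" where "arrow \<equiv> base_arrow S \<mu>"

abbreviation base_corr :: "'a \<Rightarrow> 'b \<Rightarrow> bool" where
  "base_corr \<alpha> \<alpha>' \<equiv> corr \<mu> \<mu>' \<alpha> \<alpha>'"

lemma corr_base_point: "base_corr \<mu> \<mu>'"
  by (simp add: corr_def base_point base_point' phi_base_point)

text \<open>Unfolds membership in a complex product into a concrete triangle. Its base
  \<open>\<theta>\<close> is some point; \<open>phi_path\<close> can carry the triangle to
  \<open>\<mu>'\<close> since it sees only basis relations.\<close>

lemma extension_side:
  assumes "m \<in> S" "\<alpha> \<in> \<Omega>" "x \<in> complex_product S (converse m) (R \<mu> \<alpha>)"
  obtains \<theta> \<nu> \<zeta> where "(\<theta>, \<nu>) \<in> m" "(\<theta>, \<zeta>) \<in> R \<mu> \<alpha>" "(\<nu>, \<zeta>) \<in> x" "x \<in> S"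
proof -
  have x: "x \<in> S" "intersection_number (converse m) (R \<mu> \<alpha>) x \<noteq> 0"
    using assms(3) by (auto simp: complex_product_def)
  moreover obtain \<nu> \<zeta> where "(\<nu>, \<zeta>) \<in> x" using X.basis_rel_nonempty[OF x(1)] by blast
  ultimately show thesis
    using that X.intersection_number_nonzero[OF X.converse_closed X.basis_rel_mem(1)]
      assms(1,2) base_point by blast
qed

text \<open>The preimage \<open>q\<close> of the relation of \<open>(\<alpha>', \<beta>')\<close>
  lies in both complex products, because \<open>\<mu>'\<close> and \<open>\<nu>'\<close> both serve
  as intermediate points. Their intersection leaves only \<open>r\<close>.\<close>

lemma phi_complex_product_side:
  assumes "x \<in> S" "y \<in> S" "x1 \<in> S" "y1 \<in> S"
    and eq: "complex_product S (converse x) y \<inter> complex_product S (converse x1) y1 = {r}"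
    and "(\<mu>', \<alpha>') \<in> \<phi> x" "(\<mu>', \<beta>') \<in> \<phi> y" "(\<nu>', \<alpha>') \<in> \<phi> x1" "(\<nu>', \<beta>') \<in> \<phi> y1"
  shows "(\<alpha>', \<beta>') \<in> \<phi> r"
proof -
  have ab: "\<alpha>' \<in> \<Omega>'" "\<beta>' \<in> \<Omega>'"
    using Y.basis_rel_points(2) phi_mem assms by blast+
  obtain q where q: "q \<in> S" "R' \<alpha>' \<beta>' = \<phi> q"
    using phi_surj Y.basis_rel_mem(1)[OF ab] by blast
  then have m: "(\<alpha>', \<beta>') \<in> \<phi> q" using Y.basis_rel_mem(2)[OF ab] by simp
  have "q \<in> complex_product S (converse u) v"
    if "u \<in> S" "v \<in> S" "(\<kappa>', \<alpha>') \<in> \<phi> u" "(\<kappa>', \<beta>') \<in> \<phi> v" for u v \<kappa>'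
  proof -
    have u: "converse u \<in> S" using that(1) by (rule X.converse_closed)
    have "intersection_number (\<phi> (converse u)) (\<phi> v) (\<phi> q) \<noteq> 0"
      using Y.intersection_number_nonzero[OF phi_mem[OF u] phi_mem[OF that(2)] phi_mem[OF q(1)] m]
        phi_converse[OF that(1)] that(3,4) by blast
    then show ?thesis
      using phi_intersection_number[OF u that(2) q(1)] q(1) by (simp add: complex_product_def)
  qed
  from this[OF assms(1,2,6,7)] this[OF assms(3,4,8,9)] have "q = r" using eq by blast
  then show ?thesis using m by simp
qed

text \<open>This is where hypothesis (ii) enters. Besides \<open>\<mu>'\<close> a second base point
  \<open>\<nu>'\<close> is chosen; the relations of a point to both bases are prescribed by the
  couple and its extension, and the three singleton conditions then fix the sides of the image
  triangle.\<close>

lemma corr_triple: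
  assumes "\<alpha> \<in> \<Omega>" "\<beta> \<in> \<Omega>" "base_corr \<gamma> \<gamma>'"
  obtains \<alpha>' \<beta>' where "base_corr \<alpha> \<alpha>'" "base_corr \<beta> \<beta>'"
    "corr \<alpha> \<alpha>' \<beta> \<beta>'" "corr \<beta> \<beta>' \<gamma> \<gamma>'" "corr \<gamma> \<gamma>' \<alpha> \<alpha>'"
proof -
  have g: "\<gamma> \<in> \<Omega>" using assms(3) by (simp add: corr_def)
  obtain m x1 y1 z1 where m: "m \<in> S"
    and ext: "is_extension S m (couple S \<mu> \<alpha> \<beta> \<gamma>) (x1, y1, z1)"
    using extendable[OF assms(1,2) g] by (metis prod_cases3)
  then have S: "x1 \<in> S" "y1 \<in> S" "z1 \<in> S"
    and x1: "x1 \<in> complex_product S (converse m) (R \<mu> \<alpha>)"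
    and y1: "y1 \<in> complex_product S (converse m) (R \<mu> \<beta>)"
    and z1: "z1 \<in> complex_product S (converse m) (R \<mu> \<gamma>)"
    and eq: "complex_product S (converse (R \<mu> \<alpha>)) (R \<mu> \<beta>) \<inter>
        complex_product S (converse x1) y1 = {R \<alpha> \<beta>}"
      "complex_product S (converse (R \<mu> \<beta>)) (R \<mu> \<gamma>) \<inter>
        complex_product S (converse y1) z1 = {R \<beta> \<gamma>}"
      "complex_product S (converse (R \<mu> \<gamma>)) (R \<mu> \<alpha>) \<inter>
        complex_product S (converse z1) x1 = {R \<gamma> \<alpha>}"
    by (simp_all add: is_extension_def couple_def)
  note mem = X.basis_rel_mem[OF base_point]
  have z': "(\<mu>', \<gamma>') \<in> \<phi> (R \<mu> \<gamma>)"
    using corr_mem_iff[OF mem(1)[OF g] assms(3)] mem(2)[OF g] by blast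
  \<comment> \<open>The second base is built from the given \<open>\<gamma>'\<close>, so that
    \<open>\<gamma>'\<close> itself stays fixed.\<close>
  obtain \<nu>' where nu: "(\<mu>', \<nu>') \<in> \<phi> m" "(\<nu>', \<gamma>') \<in> \<phi> z1"
  proof -
    obtain \<theta> \<nu> \<zeta> where t: "(\<theta>, \<nu>) \<in> m" "(\<theta>, \<zeta>) \<in> R \<mu> \<gamma>" "(\<nu>, \<zeta>) \<in> z1"
      using extension_side[OF m g z1] .
    then show thesis
      using that phi_path[OF m S(3) mem(1)[OF g] t(2) z'] by blast
  qed
  \<comment> \<open>Once the edge from \<open>\<mu>'\<close> to \<open>\<nu>'\<close> is fixed, the
    other vertices can be chosen over it independently.\<close>
  have side: "\<exists>\<delta>'. (\<mu>', \<delta>') \<in> \<phi> (R \<mu> \<delta>) \<and> (\<nu>', \<delta>') \<in> \<phi> w"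
    if d: "\<delta> \<in> \<Omega>" and w: "w \<in> complex_product S (converse m) (R \<mu> \<delta>)" for \<delta> w
  proof -
    obtain \<theta> \<nu> \<zeta> where t: "(\<theta>, \<nu>) \<in> m" "(\<theta>, \<zeta>) \<in> R \<mu> \<delta>" "(\<nu>, \<zeta>) \<in> w" "w \<in> S"
      using extension_side[OF m d w] .
    then obtain \<delta>' where "(\<mu>', \<delta>') \<in> \<phi> (R \<mu> \<delta>)" "(\<delta>', \<nu>') \<in> \<phi> (converse w)"
      using phi_path[OF mem(1)[OF d] X.converse_closed[OF t(4)] m t(1) nu(1)] by blast
    then show ?thesis using phi_converse[OF t(4)] by auto
  qed
  obtain \<alpha>' where a: "(\<mu>', \<alpha>') \<in> \<phi> (R \<mu> \<alpha>)" "(\<nu>', \<alpha>') \<in> \<phi> x1"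
    using side[OF assms(1) x1] by blast
  obtain \<beta>' where b: "(\<mu>', \<beta>') \<in> \<phi> (R \<mu> \<beta>)" "(\<nu>', \<beta>') \<in> \<phi> y1"
    using side[OF assms(2) y1] by blast
  note side = phi_complex_product_side[OF mem(1) mem(1)]
  have "(\<alpha>', \<beta>') \<in> \<phi> (R \<alpha> \<beta>)"
    by (rule side[OF assms(1,2) S(1,2) eq(1) a(1) b(1) a(2) b(2)])
  moreover have "(\<beta>', \<gamma>') \<in> \<phi> (R \<beta> \<gamma>)"
    by (rule side[OF assms(2) g S(2,3) eq(2) b(1) z' b(2) nu(2)])
  moreover have "(\<gamma>', \<alpha>') \<in> \<phi> (R \<gamma> \<alpha>)"
    by (rule side[OF g assms(1) S(3,1) eq(3) z' a(1) nu(2) a(2)])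
  ultimately show thesis
    using that corrI mem X.basis_rel_mem a(1) b(1) assms(1,2) g by meson
qed

section \<open>Images of points determined by a dominating point\<close>

definition lifts :: "'a \<Rightarrow> 'b \<Rightarrow> 'a \<Rightarrow> 'b \<Rightarrow> bool" where
  "lifts \<kappa> \<kappa>' \<alpha> \<alpha>' \<longleftrightarrow>
     arrow \<alpha> \<kappa> \<and> base_corr \<kappa> \<kappa>' \<and> base_corr \<alpha> \<alpha>' \<and> corr \<alpha> \<alpha>' \<kappa> \<kappa>'"

text \<open>The arrow is an intersection number equal to 1; \<open>\<phi>\<close> preserves it, so
  only one point completes the triangle on \<open>\<mu>'\<close> and
  \<open>\<kappa>'\<close>.\<close>

lemma lifts_unique:
  assumes "lifts \<kappa> \<kappa>' \<alpha> \<alpha>1" "lifts \<kappa> \<kappa>' \<alpha> \<alpha>2"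
  shows "\<alpha>1 = \<alpha>2"
proof -
  have c: "base_corr \<kappa> \<kappa>'" "arrow \<alpha> \<kappa>" and pts: "\<alpha> \<in> \<Omega>" "\<kappa> \<in> \<Omega>"
    using assms(1) by (auto simp: lifts_def corr_def)
  note x = X.basis_rel_mem[OF base_point pts(1)] and r = X.basis_rel_mem[OF pts]
    and y = X.basis_rel_mem[OF base_point pts(2)]
  have y': "(\<mu>', \<kappa>') \<in> \<phi> (R \<mu> \<kappa>)" using corr_mem_iff[OF y(1) c(1)] y(2) by blast
  let ?A = "{\<alpha>'. (\<mu>', \<alpha>') \<in> \<phi> (R \<mu> \<alpha>) \<and> (\<alpha>', \<kappa>') \<in> \<phi> (R \<alpha> \<kappa>)}"
  have "card ?A = 1"
    using Y.intersection_number_eq[OF phi_mem phi_mem phi_mem y', OF x(1) r(1) y(1)]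
      phi_intersection_number[OF x(1) r(1) y(1)] c(2)
    by (simp add: base_arrow_def)
  then obtain a where a: "?A = {a}" by (rule card_1_singletonE)
  have "\<alpha>' \<in> ?A" if "lifts \<kappa> \<kappa>' \<alpha> \<alpha>'" for \<alpha>'
    using that corr_mem_iff[OF x(1)] corr_mem_iff[OF r(1)] x(2) r(2) unfolding lifts_def by blast
  from this[OF assms(1)] this[OF assms(2)] show ?thesis unfolding a by simp
qed

lemma lifts_exists:
  assumes "arrow \<alpha> \<kappa>" "\<alpha> \<in> \<Omega>" "base_corr \<kappa> \<kappa>'"
  obtains \<alpha>' where "lifts \<kappa> \<kappa>' \<alpha> \<alpha>'"
proof -
  obtain \<alpha>' where "base_corr \<alpha> \<alpha>'" "corr \<alpha> \<alpha>' \<kappa> \<kappa>'"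
    using corr_extend[OF assms(3,2)] .
  then show thesis using that assms(1,3) unfolding lifts_def by blast
qed

lemma lifts_from:
  assumes "arrow \<alpha> \<kappa>" "\<kappa> \<in> \<Omega>" "base_corr \<alpha> \<alpha>'"
  obtains \<kappa>' where "lifts \<kappa> \<kappa>' \<alpha> \<alpha>'"
proof -
  obtain \<kappa>' where "base_corr \<kappa> \<kappa>'" "corr \<kappa> \<kappa>' \<alpha> \<alpha>'"
    using corr_extend[OF assms(3,2)] .
  then show thesis using that assms(1,3) corr_sym unfolding lifts_def by metis
qed

text \<open>\<open>corr_triple\<close> supplies some compatible images of \<open>\<alpha>\<close>
  and \<open>\<beta>\<close> over \<open>\<kappa>'\<close>; by uniqueness they are the given
  ones.\<close>

lemma lifts_corr:
  assumes "lifts \<kappa> \<kappa>' \<alpha> \<alpha>'" "lifts \<kappa> \<kappa>' \<beta> \<beta>'"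
  shows "corr \<alpha> \<alpha>' \<beta> \<beta>'"
proof -
  have c: "\<alpha> \<in> \<Omega>" "\<beta> \<in> \<Omega>" "base_corr \<kappa> \<kappa>'" using assms by (auto simp: lifts_def corr_def)
  obtain \<alpha>1 \<beta>1 where t: "base_corr \<alpha> \<alpha>1" "base_corr \<beta> \<beta>1"
    "corr \<alpha> \<alpha>1 \<beta> \<beta>1" "corr \<beta> \<beta>1 \<kappa> \<kappa>'" "corr \<kappa> \<kappa>' \<alpha> \<alpha>1"
    using corr_triple[OF c] .
  have "lifts \<kappa> \<kappa>' \<alpha> \<alpha>1" "lifts \<kappa> \<kappa>' \<beta> \<beta>1"
    using assms t(1,2,4) corr_sym[OF t(5)] by (simp_all add: lifts_def)
  then show ?thesis using t(3) lifts_unique assms by metis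
qed

text \<open>Change of the dominating point: lifting through the intermediate image
  \<open>\<omega>'\<close> gives the same image of \<open>\<alpha>\<close>.\<close>

lemma lifts_descend:
  assumes "lifts \<kappa> \<kappa>' \<alpha> \<alpha>'" "lifts \<kappa> \<kappa>' \<omega> \<omega>'" "arrow \<alpha> \<omega>"
  shows "lifts \<omega> \<omega>' \<alpha> \<alpha>'"
  using lifts_corr[OF assms(1,2)] assms by (auto simp: lifts_def)

lemma dominating_point:
  assumes "\<alpha> \<in> \<Omega>" "\<beta> \<in> \<Omega>" "\<gamma> \<in> \<Omega>" "\<delta> \<in> \<Omega>"
  obtains \<kappa> where "\<kappa> \<in> \<Omega>" "arrow \<alpha> \<kappa>" "arrow \<beta> \<kappa>" "arrow \<gamma> \<kappa>" "arrow \<delta> \<kappa>"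
proof -
  have "card (set [\<alpha>, \<beta>, \<gamma>, \<delta>]) \<le> 4" by (rule order_trans[OF card_length]) simp
  then obtain \<kappa> where "\<kappa> \<in> \<Omega>" "\<forall>\<eta>\<in>set [\<alpha>, \<beta>, \<gamma>, \<delta>]. arrow \<eta> \<kappa>"
    using dominated[of "set [\<alpha>, \<beta>, \<gamma>, \<delta>]"] assms by auto
  then show thesis using that by auto
qed

section \<open>Image pairs and their independence of the dominating point\<close>

definition pair_image :: "'a \<Rightarrow> 'a \<Rightarrow> 'b \<Rightarrow> 'b \<Rightarrow> bool" where
  "pair_image \<alpha> \<beta> \<alpha>' \<beta>' \<longleftrightarrow> (\<exists>\<kappa> \<kappa>'. lifts \<kappa> \<kappa>' \<alpha> \<alpha>' \<and> lifts \<kappa> \<kappa>' \<beta> \<beta>')"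

lemma pair_imageI: "lifts \<kappa> \<kappa>' \<alpha> \<alpha>' \<Longrightarrow> lifts \<kappa> \<kappa>' \<beta> \<beta>' \<Longrightarrow> pair_image \<alpha> \<beta> \<alpha>' \<beta>'"
  by (auto simp: pair_image_def)

text \<open>An image pair realized over some \<open>\<eta>\<close> is realized over every
  \<open>\<kappa>\<close> dominating both points: go up to a common \<open>\<rho>\<close> above
  \<open>\<eta>\<close> and \<open>\<kappa>\<close>, then down to \<open>\<kappa>\<close>.\<close>

lemma pair_image_lifts:
  assumes "pair_image \<alpha> \<beta> \<alpha>' \<beta>'" "arrow \<alpha> \<kappa>" "arrow \<beta> \<kappa>" "\<kappa> \<in> \<Omega>"
  obtains \<kappa>' where "lifts \<kappa> \<kappa>' \<alpha> \<alpha>'" "lifts \<kappa> \<kappa>' \<beta> \<beta>'"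
proof -
  obtain \<eta> \<eta>' where h: "lifts \<eta> \<eta>' \<alpha> \<alpha>'" "lifts \<eta> \<eta>' \<beta> \<beta>'"
    using assms(1) by (auto simp: pair_image_def)
  then have pts: "\<alpha> \<in> \<Omega>" "\<beta> \<in> \<Omega>" "\<eta> \<in> \<Omega>" and arr: "arrow \<alpha> \<eta>" "arrow \<beta> \<eta>"
    and "base_corr \<eta> \<eta>'"
    by (auto simp: lifts_def corr_def)
  \<comment> \<open>The bound 4 in hypothesis (i) is met here: two points and two dominating
    points.\<close>
  obtain \<rho> where r: "\<rho> \<in> \<Omega>" "arrow \<alpha> \<rho>" "arrow \<beta> \<rho>" "arrow \<eta> \<rho>" "arrow \<kappa> \<rho>"
    using dominating_point[OF pts assms(4)] .
  obtain \<rho>' where r': "lifts \<rho> \<rho>' \<eta> \<eta>'"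
    using lifts_from[OF r(4,1) \<open>base_corr \<eta> \<eta>'\<close>] .
  then have "base_corr \<rho> \<rho>'" by (simp add: lifts_def)
  then obtain \<kappa>' where k': "lifts \<rho> \<rho>' \<kappa> \<kappa>'" using lifts_exists r(5) assms(4) by blast
  \<comment> \<open>Used for \<open>\<alpha>\<close> and \<open>\<beta>\<close>: the lift over
    \<open>\<rho>'\<close> descends to \<open>\<eta>'\<close>, where uniqueness identifies it with
    \<open>\<delta>'\<close>, and also to \<open>\<kappa>'\<close>.\<close>
  have "lifts \<kappa> \<kappa>' \<delta> \<delta>'"
    if d: "\<delta> \<in> \<Omega>" "arrow \<delta> \<rho>" "arrow \<delta> \<eta>" "arrow \<delta> \<kappa>" "lifts \<eta> \<eta>' \<delta> \<delta>'" for \<delta> \<delta>'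
  proof -
    obtain \<delta>1 where d1: "lifts \<rho> \<rho>' \<delta> \<delta>1"
      using lifts_exists[OF d(2,1) \<open>base_corr \<rho> \<rho>'\<close>] .
    then have "\<delta>1 = \<delta>'" using lifts_unique[OF lifts_descend[OF d1 r' d(3)] d(5)] by simp
    then show ?thesis using lifts_descend[OF d1 k' d(4)] by simp
  qed
  then show thesis using that h pts arr r assms(2,3) by blast
qed

text \<open>One \<open>\<kappa>\<close> dominates all three points, and by
  \<open>pair_image_lifts\<close> some \<open>\<kappa>'\<close> realizes the given pair; lifting
  \<open>\<gamma>\<close> over this same \<open>\<kappa>'\<close> makes all pairs
  compatible.\<close>

lemma pair_image_extend:
  assumes "pair_image \<alpha> \<beta> \<alpha>' \<beta>'" "\<gamma> \<in> \<Omega>"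
  obtains \<gamma>' where "pair_image \<alpha> \<gamma> \<alpha>' \<gamma>'" "pair_image \<gamma> \<beta> \<gamma>' \<beta>'" "corr \<gamma> \<gamma>' \<beta> \<beta>'"
proof -
  have pts: "\<alpha> \<in> \<Omega>" "\<beta> \<in> \<Omega>" using assms(1) by (auto simp: pair_image_def lifts_def corr_def)
  obtain \<kappa> where k: "\<kappa> \<in> \<Omega>" "arrow \<alpha> \<kappa>" "arrow \<beta> \<kappa>" "arrow \<gamma> \<kappa>"
    using dominating_point[OF pts assms(2,2)] .
  obtain \<kappa>' where k': "lifts \<kappa> \<kappa>' \<alpha> \<alpha>'" "lifts \<kappa> \<kappa>' \<beta> \<beta>'"
    using pair_image_lifts[OF assms(1) k(2,3,1)] .
  then obtain \<gamma>' where "lifts \<kappa> \<kappa>' \<gamma> \<gamma>'"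
    using lifts_exists[OF k(4) assms(2)] unfolding lifts_def by blast
  then show thesis using that pair_imageI lifts_corr k' by blast
qed

section \<open>A point whose image determines all others, and the resulting isomorphism\<close>

definition determines :: "'a \<Rightarrow> 'a \<Rightarrow> bool" where
  "determines \<omega> \<alpha> \<longleftrightarrow>
     (\<forall>\<omega>' \<alpha>1 \<alpha>2. pair_image \<omega> \<alpha> \<omega>' \<alpha>1 \<longrightarrow> pair_image \<omega> \<alpha> \<omega>' \<alpha>2 \<longrightarrow> \<alpha>1 = \<alpha>2)"

text \<open>Whatever \<open>\<kappa>'\<close> realizes the pair, the image of
  \<open>\<alpha>\<close> descends to a lift over \<open>\<omega>'\<close>, which is unique.\<close>

lemma arrow_determines: "arrow \<alpha> \<omega> \<Longrightarrow> determines \<omega> \<alpha>"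
  unfolding determines_def pair_image_def by (metis lifts_descend lifts_unique)

text \<open>Each image pair of \<open>\<gamma>\<close> and \<open>\<alpha>\<close> extends through
  an image of \<open>\<beta>\<close>. The first assumption makes these images of
  \<open>\<beta>\<close> agree, the second then those of \<open>\<alpha>\<close>.\<close>

lemma determines_trans:
  assumes "determines \<gamma> \<beta>" "determines \<beta> \<alpha>" "\<beta> \<in> \<Omega>"
  shows "determines \<gamma> \<alpha>"
  unfolding determines_def
proof (intro allI impI)
  fix \<gamma>' \<alpha>1 \<alpha>2 assume p: "pair_image \<gamma> \<alpha> \<gamma>' \<alpha>1" "pair_image \<gamma> \<alpha> \<gamma>' \<alpha>2"
  obtain \<beta>1 where "pair_image \<gamma> \<beta> \<gamma>' \<beta>1" "pair_image \<beta> \<alpha> \<beta>1 \<alpha>1"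
    using pair_image_extend[OF p(1) assms(3)] by blast
  moreover obtain \<beta>2 where "pair_image \<gamma> \<beta> \<gamma>' \<beta>2" "pair_image \<beta> \<alpha> \<beta>2 \<alpha>2"
    using pair_image_extend[OF p(2) assms(3)] by blast
  ultimately show "\<alpha>1 = \<alpha>2" using assms(1,2) unfolding determines_def by blast
qed

lemma determining_point_subset:
  assumes "finite \<Delta>" "\<Delta> \<subseteq> \<Omega>"
  shows "\<exists>\<omega>\<in>\<Omega>. \<forall>\<alpha>\<in>\<Delta>. determines \<omega> \<alpha>"
  using assms
proof (induction \<Delta> rule: finite_induct)
  case empty
  then show ?case using base_point by blast
next
  case (insert \<delta> \<Delta>)
  then obtain \<omega> where l: "\<omega> \<in> \<Omega>" "\<forall>\<alpha>\<in>\<Delta>. determines \<omega> \<alpha>" by blast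
  \<comment> \<open>A point above both the inductive \<open>\<omega>\<close> and the new
    \<open>\<delta>\<close>; transitivity passes from \<open>\<kappa>\<close> through
    \<open>\<omega>\<close> to the old points.\<close>
  obtain \<kappa> where "\<kappa> \<in> \<Omega>" "arrow \<omega> \<kappa>" "arrow \<delta> \<kappa>"
    using dominating_point[OF l(1) l(1) l(1), of \<delta>] insert.prems by blast
  then show ?case using arrow_determines determines_trans l by blast
qed

lemma pair_image_diagonal:
  assumes "base_corr \<omega> \<omega>'"
  shows "pair_image \<omega> \<omega> \<omega>' \<omega>'"
proof -
  have "\<omega> \<in> \<Omega>" using assms by (simp add: corr_def)
  then obtain \<kappa> where "\<kappa> \<in> \<Omega>" "arrow \<omega> \<kappa>" using dominating_point by metis
  then show ?thesis using lifts_from[of \<omega> \<kappa> \<omega>'] assms pair_imageI by metis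
qed

lemma induced_by_pointed_isomorphism:
  "\<exists>f. cc_isomorphism \<Omega> S \<Omega>' S' f \<and> induces S f \<phi> \<and> f \<mu> = \<mu>'"
proof -
  obtain \<omega> where l: "\<omega> \<in> \<Omega>" "\<forall>\<alpha>\<in>\<Omega>. determines \<omega> \<alpha>"
    using determining_point_subset[OF X.finite_points subset_refl] by blast
  obtain \<omega>' where l': "base_corr \<omega> \<omega>'" using corr_extend[OF corr_base_point l(1)] .
  have ex: "\<exists>\<alpha>'. pair_image \<omega> \<alpha> \<omega>' \<alpha>'" if "\<alpha> \<in> \<Omega>" for \<alpha>
    using pair_image_extend[OF pair_image_diagonal[OF l'] that] by blast
  define f where "f \<alpha> = (SOME \<alpha>'. pair_image \<omega> \<alpha> \<omega>' \<alpha>')" for \<alpha>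
  have f: "pair_image \<omega> \<alpha> \<omega>' (f \<alpha>)" if "\<alpha> \<in> \<Omega>" for \<alpha>
    unfolding f_def using someI_ex[OF ex[OF that]] .
  have corr: "corr \<alpha> (f \<alpha>) \<beta> (f \<beta>)" if ab: "\<alpha> \<in> \<Omega>" "\<beta> \<in> \<Omega>" for \<alpha> \<beta>
  proof -
    \<comment> \<open>Extending the image pair of \<open>\<omega>\<close> and \<open>\<beta>\<close>
      by \<open>\<alpha>\<close> gives an image compatible with \<open>f \<beta>\<close>; since
      \<open>\<omega>\<close> determines \<open>\<alpha>\<close>, it equals
      \<open>f \<alpha>\<close>.\<close>
    obtain \<alpha>' where "pair_image \<omega> \<alpha> \<omega>' \<alpha>'" "corr \<alpha> \<alpha>' \<beta> (f \<beta>)"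
      using pair_image_extend[OF f[OF ab(2)] ab(1)] by blast
    then show ?thesis using l(2) f[OF ab(1)] ab(1) unfolding determines_def by metis
  qed
  have "cc_isomorphism \<Omega> S \<Omega>' S' f \<and> induces S f \<phi>"
    by (rule induced_by_corr_map[OF card_points_eq[OF base_point base_point' phi_base_point] corr])
  \<comment> \<open>This puts \<open>(\<mu>', f \<mu>)\<close> into the image of a diagonal
    relation.\<close>
  moreover have "base_corr \<mu> (f \<mu>)"
    using f[OF base_point] by (auto simp: pair_image_def lifts_def)
  then have "f \<mu> = \<mu>'"
    using phi_diagonal X.basis_rel_mem[OF base_point base_point] corr_mem_iff by metis
  ultimately show ?thesis by blast
qed

end

section \<open>Passage to arbitrary targets, and separability\<close>

theorem theorem4p1:
  fixes \<Omega> :: "'a set" and S :: "'a rel set" and \<mu> :: 'a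
  assumes "coherent_configuration \<Omega> S"
    and "\<mu> \<in> \<Omega>"
    and "\<forall>\<Delta> \<subseteq> \<Omega>. card \<Delta> \<le> 4 \<longrightarrow> (\<exists>l\<in>\<Omega>. \<forall>\<delta>\<in>\<Delta>. base_arrow S \<mu> \<delta> l)"
    and "\<forall>\<alpha>\<in>\<Omega>. \<forall>\<beta>\<in>\<Omega>. \<forall>\<gamma>\<in>\<Omega>. \<exists>m\<in>S. m `` {\<mu>} \<noteq> {} \<and>
           (\<exists>E. is_extension S m (couple S \<mu> \<alpha> \<beta> \<gamma>) E)"
  shows "(\<forall>(\<Omega>' :: 'b set) S' \<phi> \<mu>'.
            coherent_configuration \<Omega>' S' \<and> algebraic_isomorphism S S' \<phi> \<and> \<mu>' \<in> \<Omega>' \<and>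
            \<phi> (basis_rel S \<mu> \<mu>) = basis_rel S' \<mu>' \<mu>' \<longrightarrow>
            (\<exists>f. cc_isomorphism \<Omega> S \<Omega>' S' f \<and> induces S f \<phi> \<and> f \<mu> = \<mu>'))
         \<and> separable TYPE('b) \<Omega> S"
proof (rule conjI)
  show main: "\<forall>(\<Omega>' :: 'b set) S' \<phi> \<mu>'.
            coherent_configuration \<Omega>' S' \<and> algebraic_isomorphism S S' \<phi> \<and> \<mu>' \<in> \<Omega>' \<and>
            \<phi> (basis_rel S \<mu> \<mu>) = basis_rel S' \<mu>' \<mu>' \<longrightarrow>
            (\<exists>f. cc_isomorphism \<Omega> S \<Omega>' S' f \<and> induces S f \<phi> \<and> f \<mu> = \<mu>')"
  proof (intro allI impI, elim conjE)
    fix \<Omega>' :: "'b set" and S' \<phi> \<mu>'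
    assume h: "coherent_configuration \<Omega>' S'" "algebraic_isomorphism S S' \<phi>" "\<mu>' \<in> \<Omega>'"
      "\<phi> (basis_rel S \<mu> \<mu>) = basis_rel S' \<mu>' \<mu>'"
    interpret Y: coherent_configuration \<Omega>' S' by (rule h(1))
    interpret X: coherent_configuration \<Omega> S by (rule assms(1))
    interpret pointed_algebraic_iso \<Omega> S \<Omega>' S' \<phi> \<mu> \<mu>'
    proof unfold_locales
      show "\<exists>m\<in>S. \<exists>E. is_extension S m (couple S \<mu> \<alpha> \<beta> \<gamma>) E"
        if "\<alpha> \<in> \<Omega>" "\<beta> \<in> \<Omega>" "\<gamma> \<in> \<Omega>" for \<alpha> \<beta> \<gamma>
        using assms(4) that by meson
    qed (use assms(2,3) h in simp_all)
    show "\<exists>f. cc_isomorphism \<Omega> S \<Omega>' S' f \<and> induces S f \<phi> \<and> f \<mu> = \<mu>'"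
      by (rule induced_by_pointed_isomorphism)
  qed
  show "separable TYPE('b) \<Omega> S"
    unfolding separable_def
  proof (intro allI impI, elim conjE)
    fix \<Omega>' :: "'b set" and S' \<phi>
    assume h: "coherent_configuration \<Omega>' S'" "algebraic_isomorphism S S' \<phi>"
    interpret Y: coherent_configuration \<Omega>' S' by (rule h(1))
    interpret X: coherent_configuration \<Omega> S by (rule assms(1))
    interpret algebraic_iso \<Omega> S \<Omega>' S' \<phi> by unfold_locales (rule h(2))
    note d = X.basis_rel_mem[OF assms(2,2)]
    \<comment> \<open>The image of the diagonal relation of \<open>\<mu>\<close> is nonempty and
      diagonal, so any pair in it supplies an admissible base point for the first claim.\<close>
    obtain \<mu>' \<nu>' where m: "(\<mu>', \<nu>') \<in> \<phi> (R \<mu> \<mu>)"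
      using Y.basis_rel_nonempty[OF phi_mem[OF d(1)]] by blast
    moreover from m have "\<mu>' = \<nu>'" by (rule phi_diagonal[OF d])
    ultimately have "\<phi> (R \<mu> \<mu>) = R' \<mu>' \<mu>'" "\<mu>' \<in> \<Omega>'"
      using Y.basis_rel_eqI Y.basis_rel_points(1) phi_mem[OF d(1)] by blast+
    then show "\<exists>f. cc_isomorphism \<Omega> S \<Omega>' S' f \<and> induces S f \<phi>"
      using main h by meson
  qed
qed

end
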